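(* Let $\mathbf{H}\in\mathbb{R}^{n\times n}$ be a symmetric matrix (the Hessian of a neural network) with eigenvalues ordered so that $|\lambda_1|\ge|\lambda_2|\ge\dots\ge|\lambda_n|$. Assume spectral power-law decay: there is $\alpha>\tfrac12$ such that $|\lambda_k|\le|\lambda_1|k^{-\alpha}$ for all $1\le k\le n$. Let $\mathbf{z}^{(1)},\dots,\mathbf{z}^{(s)}\in\{-1,1\}^n$ be $s\ge1$ independent Rademacher vectors and let $$\mathrm{D}^{(s)}(\mathbf{H})=\frac1s\sum_{k=1}^s\mathbf{z}^{(k)}\odot(\mathbf{H}\mathbf{z}^{(k)}).$$ Then $$\sum_{i=1}^n\mathrm{Var}\big(\mathrm{D}^{(s)}(\mathbf{H})_i\big)\le\frac1s|\lambda_1|^2\zeta(2\alpha),$$ an upper bound that does not depend on the dimension $n$ (given $|\lambda_1|$, $\alpha$ and $s$).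
   Context: A Rademacher vector in $\mathbb{R}^n$ has i.i.d. entries taking the values $\pm1$ with probability $\tfrac12$ each. $\odot$ is the entrywise (Hadamard) product. $\zeta(t)=\sum_{k=1}^\infty k^{-t}$ for $t>1$ is the Riemann zeta function. *)

theory Defs
  imports "HOL-Probability.Probability" "Jordan_Normal_Form.Char_Poly"
begin

no_notation vec_nth (infixl \<open>$\<close> 90)

definition zeta :: "real \<Rightarrow> real" where
  "zeta t = (\<Sum>k. real (Suc k) powr (- t))"

definition hadamard_vec :: "real Matrix.vec \<Rightarrow> real Matrix.vec \<Rightarrow> real Matrix.vec" where
  "hadamard_vec u v = Matrix.vec (dim_vec u) (\<lambda>i. u $ i * v $ i)"

definition sign_vecs :: "nat \<Rightarrow> real Matrix.vec set" where
  "sign_vecs n = {v \<in> carrier_vec n. \<forall>i<n. v $ i \<in> {-1, 1}}"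

definition rademacher_vector :: "'w measure \<Rightarrow> nat \<Rightarrow> ('w \<Rightarrow> real Matrix.vec) \<Rightarrow> bool" where
  "rademacher_vector M n X \<longleftrightarrow>
     (\<forall>\<omega>\<in>space M. X \<omega> \<in> sign_vecs n) \<and>
     prob_space.indep_vars M (\<lambda>_. borel) (\<lambda>i \<omega>. X \<omega> $ i) {..<n} \<and>
     (\<forall>i<n. measure M {\<omega> \<in> space M. X \<omega> $ i = 1} = 1 / 2 \<and>
            measure M {\<omega> \<in> space M. X \<omega> $ i = -1} = 1 / 2)"

(* The type of vectors carries no measurable structure in the library; since the values lie in
   the finite set of sign vectors, that set with its discrete sigma-algebra is the target space. *)
definition indep_rademacher_vectors ::
    "'w measure \<Rightarrow> nat \<Rightarrow> nat \<Rightarrow> (nat \<Rightarrow> 'w \<Rightarrow> real Matrix.vec) \<Rightarrow> bool" where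
  "indep_rademacher_vectors M n s z \<longleftrightarrow>
     (\<forall>k\<in>{1..s}. rademacher_vector M n (z k)) \<and>
     prob_space.indep_vars M (\<lambda>_. count_space (sign_vecs n)) z {1..s}"

(* lam 1, ..., lam n list the eigenvalues with algebraic multiplicity, by decreasing modulus. *)
definition ordered_eigenvalues :: "real Matrix.mat \<Rightarrow> nat \<Rightarrow> (nat \<Rightarrow> real) \<Rightarrow> bool" where
  "ordered_eigenvalues H n lam \<longleftrightarrow>
     char_poly H = (\<Prod>k=1..n. [:- lam k, 1:]) \<and>
     (\<forall>j k. 1 \<le> j \<and> j \<le> k \<and> k \<le> n \<longrightarrow> \<bar>lam k\<bar> \<le> \<bar>lam j\<bar>)"

definition diag_estimator ::
    "nat \<Rightarrow> nat \<Rightarrow> real Matrix.mat \<Rightarrow> (nat \<Rightarrow> real Matrix.vec) \<Rightarrow> real Matrix.vec" where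
  "diag_estimator n s H z =
     (1 / real s) \<cdot>\<^sub>v finsum_vec TYPE(real) n (\<lambda>k. hadamard_vec (z k) (H *\<^sub>v z k)) {1..s}"

end

theory Submission
  imports Defs "Jordan_Normal_Form.Schur_Decomposition"
begin

text \<open>Since \<open>z\<^sub>i\<^sup>2 = 1\<close>, the \<open>i\<close>-th entry \<open>z\<^sub>i (H z)\<^sub>i\<close> of a single sample has the second moment
  \<open>E (H z)\<^sub>i\<^sup>2 = \<Sum>\<^sub>j H\<^sub>i\<^sub>j\<^sup>2\<close>, which bounds its variance. By independence of the samples, the
  total variance is thus at most \<open>1/s\<close> times the squared Frobenius norm of \<open>H\<close>. For symmetric
  \<open>H\<close> this norm is the trace of \<open>H\<^sup>2\<close>, that is the sum of the squared eigenvalues, and the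
  power law compares it with the zeta series.\<close>

section \<open>Squared eigenvalues and the trace of the square\<close>

text \<open>Cyclicity of the trace. It removes the change of basis once the matrix has been
  triangularised.\<close>

lemma sum_diag_mult_commute:
  fixes A B :: "'a::comm_semiring_0 mat"
  assumes A: "A \<in> carrier_mat n m" and B: "B \<in> carrier_mat m n"
  shows "(\<Sum>i<n. (A * B) $$ (i, i)) = (\<Sum>j<m. (B * A) $$ (j, j))"
proof -
  have "(\<Sum>i<n. (A * B) $$ (i, i)) = (\<Sum>i<n. \<Sum>j<m. A $$ (i, j) * B $$ (j, i))"
    using A B by (intro sum.cong refl) (auto simp: scalar_prod_def atLeast0LessThan)
  also have "\<dots> = (\<Sum>j<m. \<Sum>i<n. B $$ (j, i) * A $$ (i, j))"
    by (subst sum.swap) (simp add: mult.commute)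
  also have "\<dots> = (\<Sum>j<m. (B * A) $$ (j, j))"
    using A B by (intro sum.cong refl) (auto simp: scalar_prod_def atLeast0LessThan)
  finally show ?thesis .
qed

text \<open>For \<open>j\<close> different from \<open>i\<close>, one of the positions
  \<open>(i, j)\<close> and \<open>(j, i)\<close> lies below the diagonal, so only the term
  \<open>j = i\<close> of the scalar product survives.\<close>

lemma upper_triangular_square_diag:
  fixes B :: "'a::semiring_0 mat"
  assumes B: "B \<in> carrier_mat n n" and tri: "upper_triangular B" and i: "i < n"
  shows "(B * B) $$ (i, i) = B $$ (i, i) * B $$ (i, i)"
proof -
  have "B $$ (i, j) * B $$ (j, i) = 0" if "j < n" "j \<noteq> i" for j
    using that i B upper_triangularD[OF tri, of i j] upper_triangularD[OF tri, of j i]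
    by (cases "j < i") auto
  then have "(\<Sum>j<n. B $$ (i, j) * B $$ (j, i)) = (\<Sum>j\<in>{i}. B $$ (i, j) * B $$ (j, i))"
    using i by (intro sum.mono_neutral_right) auto
  then show ?thesis
    using B i by (auto simp: scalar_prod_def atLeast0LessThan)
qed

text \<open>The Schur decomposition gives \<open>A = P * B * Q\<close> with \<open>B\<close> upper
  triangular and \<open>es\<close> on its diagonal. Then \<open>A * A\<close> is similar to
  \<open>B * B\<close>, whose diagonal holds the squares of \<open>es\<close>.\<close>

lemma sum_diag_square_eq_sum_eigenvalues:
  fixes A :: "'a::conjugatable_ordered_field mat"
  assumes A: "A \<in> carrier_mat n n" and cp: "char_poly A = (\<Prod>e\<leftarrow>es. [:- e, 1:])"
  shows "(\<Sum>i<n. (A * A) $$ (i, i)) = (\<Sum>e\<leftarrow>es. e\<^sup>2)"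
proof -
  obtain B P Q where dec: "schur_decomposition A es = (B, P, Q)"
    by (cases "schur_decomposition A es") auto
  note schur = schur_decomposition[OF A cp dec]
  from schur have diag: "diag_mat B = es" and tri: "upper_triangular B" by auto
  from similar_mat_witD2[OF A] schur
  have QP: "Q * P = 1\<^sub>m n" and AB: "A = P * B * Q"
    and B: "B \<in> carrier_mat n n" and P: "P \<in> carrier_mat n n" and Q: "Q \<in> carrier_mat n n"
    by auto
  have "A * A = P * B * (Q * P) * (B * Q)"
    unfolding AB using P Q B by (simp add: assoc_mult_mat[of _ n n _ n _ n])
  also have "\<dots> = P * (B * B * Q)"
    unfolding QP using P Q B by (simp add: assoc_mult_mat[of _ n n _ n _ n])
  finally have "(\<Sum>i<n. (A * A) $$ (i, i)) = (\<Sum>i<n. (P * (B * B * Q)) $$ (i, i))"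
    by simp
  also have "\<dots> = (\<Sum>i<n. (B * B * Q * P) $$ (i, i))"
    using P Q B by (intro sum_diag_mult_commute) auto
  also have "B * B * Q * P = B * B"
    using P Q B QP by (simp add: assoc_mult_mat[of _ n n _ n _ n])
  also have "(\<Sum>i<n. (B * B) $$ (i, i)) = (\<Sum>i<n. (B $$ (i, i))\<^sup>2)"
    by (intro sum.cong refl)
      (simp only: lessThan_iff upper_triangular_square_diag[OF B tri] power2_eq_square)
  also have "\<dots> = (\<Sum>e\<leftarrow>diag_mat B. e\<^sup>2)"
    using B by (simp add: diag_mat_def comp_def interv_sum_list_conv_sum_set_nat atLeast0LessThan)
  finally show ?thesis
    unfolding diag .
qed

text \<open>By symmetry \<open>A $$ (i, j) * A $$ (j, i)\<close> is a square, so the trace of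
  \<open>A * A\<close> is the squared Frobenius norm. This links the entries, which control the
  variance, to the spectrum.\<close>

lemma frobenius_norm_eq_sum_eigenvalues:
  fixes A :: "'a::conjugatable_ordered_field mat"
  assumes A: "A \<in> carrier_mat n n" and sym: "transpose_mat A = A"
    and cp: "char_poly A = (\<Prod>k=1..n. [:- l k, 1:])"
  shows "(\<Sum>i<n. \<Sum>j<n. (A $$ (i, j))\<^sup>2) = (\<Sum>k=1..n. (l k)\<^sup>2)"
proof -
  have entry: "A $$ (j, i) = A $$ (i, j)" if "i < n" "j < n" for i j
    using that A by (subst sym[symmetric]) simp
  \<comment> \<open>The Schur decomposition takes the eigenvalues as a list, so the product over the
    set \<open>{1..n}\<close> becomes one over \<open>[1..<Suc n]\<close>.\<close>
  have "char_poly A = (\<Prod>e\<leftarrow>map l [1..<Suc n]. [:- e, 1:])"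
    unfolding cp map_map comp_def
    by (subst prod.distinct_set_conv_list[symmetric])
      (simp_all add: atLeastLessThanSuc_atLeastAtMost del: upt_Suc)
  from sum_diag_square_eq_sum_eigenvalues[OF A this]
  have "(\<Sum>i<n. (A * A) $$ (i, i)) = (\<Sum>k=1..n. (l k)\<^sup>2)"
    by (simp only: map_map comp_def interv_sum_list_conv_sum_set_nat set_upt
        atLeastLessThanSuc_atLeastAtMost)
  moreover have "(\<Sum>i<n. (A * A) $$ (i, i)) = (\<Sum>i<n. \<Sum>j<n. (A $$ (i, j))\<^sup>2)"
    using A entry
    by (intro sum.cong refl) (auto simp: scalar_prod_def atLeast0LessThan power2_eq_square)
  ultimately show ?thesis by simp
qed

section \<open>Second moments of independent sums\<close>

text \<open>After expanding the square, each mixed expectation factors by independence and vanishes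
  because the means are zero.\<close>

lemma (in prob_space) expectation_square_sum_indep:
  fixes Z :: "'i \<Rightarrow> 'a \<Rightarrow> real"
  assumes fin: "finite I" and ind: "indep_vars (\<lambda>_. borel) Z I"
    and int: "\<And>k. k \<in> I \<Longrightarrow> integrable M (Z k)"
    and sq: "\<And>k. k \<in> I \<Longrightarrow> integrable M (\<lambda>x. (Z k x)\<^sup>2)"
    and mean: "\<And>k. k \<in> I \<Longrightarrow> expectation (Z k) = 0"
  shows "expectation (\<lambda>x. (\<Sum>k\<in>I. Z k x)\<^sup>2) = (\<Sum>k\<in>I. expectation (\<lambda>x. (Z k x)\<^sup>2))"
proof -
  have cross: "integrable M (\<lambda>x. Z j x * Z k x)"
    "expectation (\<lambda>x. Z j x * Z k x) = (if j = k then expectation (\<lambda>x. (Z k x)\<^sup>2) else 0)"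
    if "j \<in> I" "k \<in> I" for j k
  proof -
    have jk: "indep_vars (\<lambda>_. borel) Z {j, k}"
      using indep_vars_subset[OF ind, of "{j, k}"] that by auto
    \<comment> \<open>If \<open>j = k\<close>, the set \<open>{j, k}\<close> is a singleton and this
      product is only \<open>Z k\<close>; integrability of the square then comes from
      \<open>sq\<close>.\<close>
    have "integrable M (\<lambda>x. \<Prod>i\<in>{j, k}. Z i x)"
      using jk int that by (intro indep_vars_integrable) auto
    then show "integrable M (\<lambda>x. Z j x * Z k x)"
      using sq[OF that(2)] by (cases "j = k") (auto simp: power2_eq_square)
    have "expectation (\<lambda>x. \<Prod>i\<in>{j, k}. Z i x) = (\<Prod>i\<in>{j, k}. expectation (Z i))"
      using jk int that by (intro indep_vars_lebesgue_integral) auto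
    then show "expectation (\<lambda>x. Z j x * Z k x) = (if j = k then expectation (\<lambda>x. (Z k x)\<^sup>2) else 0)"
      using mean that by (auto simp: power2_eq_square)
  qed
  have "expectation (\<lambda>x. (\<Sum>k\<in>I. Z k x)\<^sup>2) = (\<Sum>j\<in>I. \<Sum>k\<in>I. expectation (\<lambda>x. Z j x * Z k x))"
    using cross(1) by (simp add: power2_eq_square sum_product)
  also have "\<dots> = (\<Sum>k\<in>I. expectation (\<lambda>x. (Z k x)\<^sup>2))"
    using fin cross(2) by (simp add: sum.delta)
  finally show ?thesis .
qed

text \<open>Centring each summand preserves independence and reduces the claim to second
  moments.\<close>

lemma (in prob_space) variance_sum_indep:
  fixes X :: "'i \<Rightarrow> 'a \<Rightarrow> real"
  assumes fin: "finite I" and ind: "indep_vars (\<lambda>_. borel) X I"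
    and int: "\<And>k. k \<in> I \<Longrightarrow> integrable M (X k)"
    and sq: "\<And>k. k \<in> I \<Longrightarrow> integrable M (\<lambda>x. (X k x)\<^sup>2)"
  shows "variance (\<lambda>x. \<Sum>k\<in>I. X k x) = (\<Sum>k\<in>I. variance (X k))"
proof -
  have "expectation (\<lambda>x. (\<Sum>k\<in>I. X k x - expectation (X k))\<^sup>2) = (\<Sum>k\<in>I. variance (X k))"
  proof (rule expectation_square_sum_indep[OF fin])
    show "indep_vars (\<lambda>_. borel) (\<lambda>k x. X k x - expectation (X k)) I"
      by (rule indep_vars_compose2[OF ind]) auto
  qed (use int sq in \<open>auto simp: power2_diff prob_space\<close>)
  then show ?thesis
    using int by (simp add: sum_subtractf)
qed

section \<open>The diagonal estimator\<close>

lemma diag_estimator_index: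
  assumes "H \<in> carrier_mat n n" and "\<And>k. k \<in> {1..s} \<Longrightarrow> z k \<in> carrier_vec n" and "i < n"
  shows "diag_estimator n s H z $ i
    = 1 / real s * (\<Sum>k=1..s. z k $ i * (\<Sum>j<n. H $$ (i, j) * z k $ j))"
proof -
  \<comment> \<open>\<open>finsum_vec\<close> can be evaluated entrywise once all its summands are
    known to have dimension \<open>n\<close>.\<close>
  have cl: "(\<lambda>k. hadamard_vec (z k) (H *\<^sub>v z k)) \<in> {1..s} \<rightarrow> carrier_vec n"
    by (intro Pi_I carrier_vecI) (simp add: hadamard_vec_def carrier_vecD[OF assms(2)])
  have "hadamard_vec (z k) (H *\<^sub>v z k) $ i = z k $ i * (\<Sum>j<n. H $$ (i, j) * z k $ j)"
    if "k \<in> {1..s}" for k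
    using assms(1,3) assms(2)[OF that]
    by (auto simp: hadamard_vec_def scalar_prod_def atLeast0LessThan)
  moreover have "dim_vec (finsum_vec TYPE(real) n (\<lambda>k. hadamard_vec (z k) (H *\<^sub>v z k)) {1..s}) = n"
    using finsum_vec_closed[OF cl] by auto
  ultimately show ?thesis
    using assms(3) by (simp add: diag_estimator_def index_finsum_vec[OF _ assms(3) cl] del: One_nat_def)
qed

context prob_space
begin

lemma rademacher_vector_entry:
  assumes rad: "rademacher_vector M n X" and i: "i < n"
  shows "integrable M (\<lambda>x. X x $ i)" and "expectation (\<lambda>x. X x $ i) = 0"
    and "\<And>x. x \<in> space M \<Longrightarrow> (X x $ i)\<^sup>2 = 1"
proof -
  have val: "X x $ i = -1 \<or> X x $ i = 1" if "x \<in> space M" for x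
    using rad i that by (auto simp: rademacher_vector_def sign_vecs_def)
  then show "\<And>x. x \<in> space M \<Longrightarrow> (X x $ i)\<^sup>2 = 1"
    by fastforce
  have meas [measurable]: "(\<lambda>x. X x $ i) \<in> borel_measurable M"
    using rad i by (auto simp: rademacher_vector_def indep_vars_def)
  have "\<bar>X x $ i\<bar> \<le> 1" if "x \<in> space M" for x
    using val[OF that] by auto
  then show "integrable M (\<lambda>x. X x $ i)"
    by (intro integrable_const_bound[where B = 1]) (auto intro!: AE_I2)
  let ?P = "{x \<in> space M. X x $ i = 1}" and ?N = "{x \<in> space M. X x $ i = -1}"
  \<comment> \<open>With only the values 1 and -1 possible, the entry is the difference of the
    indicators of its two level sets.\<close>
  have "expectation (\<lambda>x. X x $ i) = expectation (\<lambda>x. indicator ?P x - indicator ?N x)"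
    by (intro Bochner_Integration.integral_cong refl) (use val in \<open>auto simp: indicator_def\<close>)
  also have "\<dots> = prob ?P - prob ?N"
    by (subst Bochner_Integration.integral_diff) (auto simp: integrable_indicator_iff emeasure_eq_measure)
  also have "\<dots> = 0"
    using rad i by (auto simp: rademacher_vector_def simp del: eq_divide_eq_numeral1)
  finally show "expectation (\<lambda>x. X x $ i) = 0" .
qed

text \<open>The terms \<open>a j * X x $ j\<close> are independent with mean zero, and their squares
  are the constants \<open>(a j)\<^sup>2\<close>.\<close>

lemma rademacher_linear_form:
  assumes rad: "rademacher_vector M n X"
  shows "expectation (\<lambda>x. (\<Sum>j<n. a j * X x $ j)\<^sup>2) = (\<Sum>j<n. (a j)\<^sup>2)"
proof -
  have sq: "(a j * X x $ j)\<^sup>2 = (a j)\<^sup>2" if "x \<in> space M" "j < n" for x j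
    using rademacher_vector_entry(3)[OF rad that(2,1)] by (simp add: power_mult_distrib)
  have sq_int: "integrable M (\<lambda>x. (a j * X x $ j)\<^sup>2)"
    and sq_mean: "expectation (\<lambda>x. (a j * X x $ j)\<^sup>2) = (a j)\<^sup>2" if "j < n" for j
    using sq that
    by (auto cong: Bochner_Integration.integrable_cong Bochner_Integration.integral_cong
        simp: prob_space)
  have "indep_vars (\<lambda>_. borel) (\<lambda>j x. X x $ j) {..<n}"
    using rad by (simp add: rademacher_vector_def)
  then have "indep_vars (\<lambda>_. borel) (\<lambda>j x. a j * X x $ j) {..<n}"
    by (rule indep_vars_compose2) auto
  then have "expectation (\<lambda>x. (\<Sum>j<n. a j * X x $ j)\<^sup>2)
      = (\<Sum>j<n. expectation (\<lambda>x. (a j * X x $ j)\<^sup>2))"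
    using rademacher_vector_entry[OF rad] sq_int
    by (intro expectation_square_sum_indep) auto
  then show ?thesis
    using sq_mean by simp
qed

text \<open>The leading sign disappears from the square of \<open>Y\<close>, which leaves the second
  moment of a linear form. Bounding the variance by this moment drops only the squared mean, which
  is \<open>(a i)\<^sup>2\<close>.\<close>

lemma rademacher_sample:
  fixes a :: "nat \<Rightarrow> real"
  assumes rad: "rademacher_vector M n X" and i: "i < n"
  defines "Y \<equiv> \<lambda>x. X x $ i * (\<Sum>j<n. a j * X x $ j)"
  shows "integrable M Y" and "integrable M (\<lambda>x. (Y x)\<^sup>2)" and "variance Y \<le> (\<Sum>j<n. (a j)\<^sup>2)"
proof -
  have meas [measurable]: "(\<lambda>x. X x $ j) \<in> borel_measurable M" if "j < n" for j
    using rademacher_vector_entry(1)[OF rad that] by auto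
  have Y_meas [measurable]: "Y \<in> borel_measurable M"
    unfolding Y_def using i by measurable
  have abs1: "\<bar>X x $ j\<bar> = 1" if "x \<in> space M" "j < n" for x j
    using rademacher_vector_entry(3)[OF rad that(2,1)] by (auto simp: power2_eq_1_iff)
  \<comment> \<open>All signs have modulus one, so a constant dominates \<open>Y\<close>; it yields
    integrability of \<open>Y\<close> and of its square.\<close>
  have bound: "\<bar>Y x\<bar> \<le> (\<Sum>j<n. \<bar>a j\<bar>)" if "x \<in> space M" for x
  proof -
    have "\<bar>Y x\<bar> = \<bar>\<Sum>j<n. a j * X x $ j\<bar>"
      using abs1[OF that i] by (simp add: Y_def abs_mult)
    also have "\<dots> \<le> (\<Sum>j<n. \<bar>a j * X x $ j\<bar>)"
      by (rule sum_abs)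
    also have "\<dots> = (\<Sum>j<n. \<bar>a j\<bar>)"
      using abs1[OF that] by (simp add: abs_mult)
    finally show ?thesis .
  qed
  show int: "integrable M Y"
    using bound by (intro integrable_const_bound[where B = "\<Sum>j<n. \<bar>a j\<bar>"]) (auto intro!: AE_I2)
  have "(Y x)\<^sup>2 \<le> (\<Sum>j<n. \<bar>a j\<bar>)\<^sup>2" if "x \<in> space M" for x
    using bound[OF that] by (metis abs_ge_zero power2_abs power_mono)
  then show sq: "integrable M (\<lambda>x. (Y x)\<^sup>2)"
    by (intro integrable_const_bound[where B = "(\<Sum>j<n. \<bar>a j\<bar>)\<^sup>2"]) (auto intro!: AE_I2)
  have "variance Y \<le> expectation (\<lambda>x. (Y x)\<^sup>2)"
    using variance_eq[OF int sq] by simp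
  also have "\<dots> = expectation (\<lambda>x. (\<Sum>j<n. a j * X x $ j)\<^sup>2)"
    using rademacher_vector_entry(3)[OF rad i]
    by (intro Bochner_Integration.integral_cong refl) (simp add: Y_def power_mult_distrib)
  also have "\<dots> = (\<Sum>j<n. (a j)\<^sup>2)"
    by (rule rademacher_linear_form[OF rad])
  finally show "variance Y \<le> (\<Sum>j<n. (a j)\<^sup>2)" .
qed

text \<open>The average contributes a factor \<open>(1 / real s)\<^sup>2\<close> and the
  \<open>s\<close> independent samples contribute equal bounds, hence the rate
  \<open>1 / real s\<close>.\<close>

lemma variance_diag_estimator_le:
  assumes H: "H \<in> carrier_mat n n" and s: "s \<ge> 1" and z: "indep_rademacher_vectors M n s z"
    and i: "i < n"
  shows "variance (\<lambda>\<omega>. diag_estimator n s H (\<lambda>k. z k \<omega>) $ i)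
    \<le> 1 / real s * (\<Sum>j<n. (H $$ (i, j))\<^sup>2)"
proof -
  \<comment> \<open>Each sample is the same function \<open>g\<close> of one random vector.
    Independence passes from \<open>z\<close> to the samples, and \<open>g\<close> is measurable
    because the sign vectors carry the discrete sigma-algebra.\<close>
  define g where "g v = v $ i * (\<Sum>j<n. H $$ (i, j) * v $ j)" for v :: "real Matrix.vec"
  have rad: "rademacher_vector M n (z k)" if "k \<in> {1..s}" for k
    using z that by (simp add: indep_rademacher_vectors_def)
  have indep_z: "indep_vars (\<lambda>_. count_space (sign_vecs n)) z {1..s}"
    using z by (simp add: indep_rademacher_vectors_def)
  note sample = rademacher_sample[OF rad i, where a = "\<lambda>j. H $$ (i, j)", folded g_def]
  have entry: "diag_estimator n s H (\<lambda>k. z k \<omega>) $ i = 1 / real s * (\<Sum>k=1..s. g (z k \<omega>))"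
    if "\<omega> \<in> space M" for \<omega>
    unfolding g_def
    using rad that by (intro diag_estimator_index[OF H _ i])
      (auto simp: rademacher_vector_def sign_vecs_def)
  have "variance (\<lambda>\<omega>. diag_estimator n s H (\<lambda>k. z k \<omega>) $ i)
      = variance (\<lambda>\<omega>. 1 / real s * (\<Sum>k=1..s. g (z k \<omega>)))"
    using entry by (simp cong: Bochner_Integration.integral_cong)
  also have "\<dots> = (1 / real s)\<^sup>2 * variance (\<lambda>\<omega>. \<Sum>k=1..s. g (z k \<omega>))"
    by (simp add: power_divide flip: diff_divide_distrib)
  also have "variance (\<lambda>\<omega>. \<Sum>k=1..s. g (z k \<omega>)) = (\<Sum>k=1..s. variance (\<lambda>\<omega>. g (z k \<omega>)))"
    using sample(1,2) by (intro variance_sum_indep indep_vars_compose2[OF indep_z]) auto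
  also have "(1 / real s)\<^sup>2 * \<dots> \<le> (1 / real s)\<^sup>2 * (\<Sum>k=1..s. \<Sum>j<n. (H $$ (i, j))\<^sup>2)"
    by (intro mult_left_mono sum_mono sample(3)) auto
  also have "\<dots> = 1 / real s * (\<Sum>j<n. (H $$ (i, j))\<^sup>2)"
    using s by (simp add: power2_eq_square)
  finally show ?thesis .
qed

end

section \<open>The spectral bound\<close>

text \<open>A partial sum of a convergent series of nonnegative terms; the index is shifted because
  \<open>zeta\<close> sums from 0 over \<open>Suc k\<close>.\<close>

lemma sum_powr_le_zeta:
  assumes "t > 1"
  shows "(\<Sum>k=1..n. real k powr (- t)) \<le> zeta t"
proof -
  have "summable (\<lambda>k. real (Suc k) powr (- t))"
    using assms by (subst summable_Suc_iff) (simp add: summable_real_powr_iff)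
  then have "(\<Sum>k<n. real (Suc k) powr (- t)) \<le> zeta t"
    unfolding zeta_def by (intro sum_le_suminf) auto
  moreover have "(\<Sum>k<n. real (Suc k) powr (- t)) = (\<Sum>k=1..n. real k powr (- t))"
    by (rule sum.reindex_bij_witness[of _ "\<lambda>k. k - 1" Suc]) auto
  ultimately show ?thesis by simp
qed

theorem theorem9:
  fixes M :: "'w measure"
    and n s :: nat
    and H :: "real Matrix.mat"
    and lam :: "nat \<Rightarrow> real"
    and \<alpha> :: real
    and z :: "nat \<Rightarrow> 'w \<Rightarrow> real Matrix.vec"
  assumes "prob_space M"
    and "n \<ge> 1"
    and "H \<in> carrier_mat n n"
    and "transpose_mat H = H"
    and "ordered_eigenvalues H n lam"
    and "\<alpha> > 1 / 2"
    and "\<forall>k\<in>{1..n}. \<bar>lam k\<bar> \<le> \<bar>lam 1\<bar> * real k powr (- \<alpha>)"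
    and "s \<ge> 1"
    and "indep_rademacher_vectors M n s z"
  shows "(\<Sum>i<n. prob_space.variance M (\<lambda>\<omega>. diag_estimator n s H (\<lambda>k. z k \<omega>) $ i))
           \<le> 1 / real s * \<bar>lam 1\<bar>\<^sup>2 * zeta (2 * \<alpha>)"
proof -
  interpret prob_space M by fact
  have "(\<Sum>i<n. variance (\<lambda>\<omega>. diag_estimator n s H (\<lambda>k. z k \<omega>) $ i))
      \<le> (\<Sum>i<n. 1 / real s * (\<Sum>j<n. (H $$ (i, j))\<^sup>2))"
    using assms(3,8,9) by (intro sum_mono variance_diag_estimator_le) auto
  \<comment> \<open>Summing the row bounds over \<open>i\<close> produces the full squared Frobenius
    norm.\<close>
  also have "\<dots> = 1 / real s * (\<Sum>k=1..n. (lam k)\<^sup>2)"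
    using assms(5)
    by (simp only: ordered_eigenvalues_def sum_distrib_left[symmetric]
        frobenius_norm_eq_sum_eigenvalues[OF assms(3,4)])
  also have "\<dots> \<le> 1 / real s * (\<bar>lam 1\<bar>\<^sup>2 * zeta (2 * \<alpha>))"
  proof (intro mult_left_mono)
    \<comment> \<open>Squaring the power law doubles the exponent. Since \<alpha> exceeds one half,
      \<open>2 * \<alpha>\<close> exceeds 1 and the zeta series converges, which makes the bound
      uniform in \<open>n\<close>.\<close>
    have "(lam k)\<^sup>2 \<le> \<bar>lam 1\<bar>\<^sup>2 * real k powr (- (2 * \<alpha>))" if k: "k \<in> {1..n}" for k
    proof -
      have "(lam k)\<^sup>2 \<le> (\<bar>lam 1\<bar> * real k powr (- \<alpha>))\<^sup>2"
        using power_mono[of "\<bar>lam k\<bar>" _ 2] assms(7) k by auto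
      moreover have "(real k powr (- \<alpha>))\<^sup>2 = real k powr (- (2 * \<alpha>))"
        by (simp add: power2_eq_square flip: powr_add)
      ultimately show ?thesis by (simp only: power_mult_distrib)
    qed
    then have "(\<Sum>k=1..n. (lam k)\<^sup>2) \<le> \<bar>lam 1\<bar>\<^sup>2 * (\<Sum>k=1..n. real k powr (- (2 * \<alpha>)))"
      unfolding sum_distrib_left by (rule sum_mono)
    also have "\<dots> \<le> \<bar>lam 1\<bar>\<^sup>2 * zeta (2 * \<alpha>)"
      using assms(6) by (intro mult_left_mono sum_powr_le_zeta) auto
    finally show "(\<Sum>k=1..n. (lam k)\<^sup>2) \<le> \<bar>lam 1\<bar>\<^sup>2 * zeta (2 * \<alpha>)" .
  qed simp
  finally show ?thesis
    by (simp only: mult.assoc)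
qed

end
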